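(* For every integer $k \geq 4$ there exists a disconnected graph that is $k$-$\chi_g$-game-vertex-critical.
   Context: All graphs are simple, undirected and finite. The coloring game on a graph $G$ with color set $\{1,\ldots,k\}$ is played by Alice and Bob. Alice moves first and the players alternate turns; in each turn the player colors a previously uncolored vertex with a color from $\{1,\ldots,k\}$ different from the colors already given to its neighbors. If at some point there is an uncolored vertex having all colors $1,\ldots,k$ in its neighborhood, Bob wins; otherwise, if all vertices get colored, Alice wins. The game chromatic number $\chi_g(G)$ is the minimum $k$ for which Alice has a winning strategy on $G$. For $x\in V(G)$, $G-x$ is the graph obtained from $G$ by deleting $x$ and all edges incident with $x$. A graph $G$ is $k$-$\chi_g$-game-vertex-critical if $\chi_g(G)=k$ and $\chi_g(G-x)\neq\chi_g(G)$ for every $x\in V(G)$. *)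

theory Defs
  imports "Graph_Theory.Graph_Theory"
begin

text \<open>
  Finite simple undirected graphs are the graphs of the library, that is, finite symmetric
  digraphs without loops and without parallel arcs; an undirected edge is a pair of opposite arcs.

  A history lists the moves made so far, in chronological order; a move \<open>(v, i)\<close> gives vertex
  \<open>v\<close> the color \<open>i\<close>.  In a play no vertex is colored twice, so \<^const>\<open>map_of\<close> is the
  current partial coloring.
\<close>

type_synonym 'a move = "'a \<times> nat"
type_synonym 'a history = "'a move list"

definition legal_move :: "('a, 'b) pre_digraph \<Rightarrow> nat \<Rightarrow> 'a history \<Rightarrow> 'a move \<Rightarrow> bool" where
  "legal_move G k h m \<longleftrightarrow> (case m of (v, i) \<Rightarrow>
     v \<in> verts G \<and> map_of h v = None \<and> i \<in> {1..k} \<and>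
     (\<forall>u. u \<rightarrow>\<^bsub>G\<^esub> v \<longrightarrow> map_of h u \<noteq> Some i))"

definition all_colored :: "('a, 'b) pre_digraph \<Rightarrow> 'a history \<Rightarrow> bool" where
  "all_colored G h \<longleftrightarrow> (\<forall>v \<in> verts G. map_of h v \<noteq> None)"

definition blocked :: "('a, 'b) pre_digraph \<Rightarrow> nat \<Rightarrow> 'a history \<Rightarrow> bool" where
  "blocked G k h \<longleftrightarrow> (\<exists>v \<in> verts G. map_of h v = None \<and>
     (\<forall>i \<in> {1..k}. \<exists>u. u \<rightarrow>\<^bsub>G\<^esub> v \<and> map_of h u = Some i))"

definition game_over :: "('a, 'b) pre_digraph \<Rightarrow> nat \<Rightarrow> 'a history \<Rightarrow> bool" where
  "game_over G k h \<longleftrightarrow> blocked G k h \<or> all_colored G h"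

inductive play :: "('a, 'b) pre_digraph \<Rightarrow> nat \<Rightarrow> 'a history \<Rightarrow> bool"
  for G :: "('a, 'b) pre_digraph" and k :: nat where
  start: "play G k []"
| move: "play G k h \<Longrightarrow> \<not> game_over G k h \<Longrightarrow> legal_move G k h m \<Longrightarrow> play G k (h @ [m])"

text \<open>
  Alice moves first, so it is her turn exactly after an even number of moves.
\<close>

definition alice_strategy ::
    "('a, 'b) pre_digraph \<Rightarrow> nat \<Rightarrow> ('a history \<Rightarrow> 'a move) \<Rightarrow> bool" where
  "alice_strategy G k \<sigma> \<longleftrightarrow> (\<forall>h. play G k h \<and> \<not> game_over G k h \<and> even (length h) \<longrightarrow>
     legal_move G k h (\<sigma> h))"

definition follows :: "('a history \<Rightarrow> 'a move) \<Rightarrow> 'a history \<Rightarrow> bool" where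
  "follows \<sigma> h \<longleftrightarrow> (\<forall>j < length h. even j \<longrightarrow> h ! j = \<sigma> (take j h))"

definition alice_winning_strategy ::
    "('a, 'b) pre_digraph \<Rightarrow> nat \<Rightarrow> ('a history \<Rightarrow> 'a move) \<Rightarrow> bool" where
  "alice_winning_strategy G k \<sigma> \<longleftrightarrow> alice_strategy G k \<sigma> \<and>
     (\<forall>h. play G k h \<and> game_over G k h \<and> follows \<sigma> h \<longrightarrow> \<not> blocked G k h)"

definition alice_wins :: "('a, 'b) pre_digraph \<Rightarrow> nat \<Rightarrow> bool" where
  "alice_wins G k \<longleftrightarrow> (\<exists>\<sigma>. alice_winning_strategy G k \<sigma>)"

definition game_chromatic_number :: "('a, 'b) pre_digraph \<Rightarrow> nat" where
  "game_chromatic_number G = (LEAST k. alice_wins G k)"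

definition game_vertex_critical :: "nat \<Rightarrow> ('a, 'b) pre_digraph \<Rightarrow> bool" where
  "game_vertex_critical k G \<longleftrightarrow> game_chromatic_number G = k \<and>
     (\<forall>x \<in> verts G. game_chromatic_number (pre_digraph.del_vert G x) \<noteq> game_chromatic_number G)"

text \<open>
  Alice wins with as many colors as there are vertices, so the minimum in
  \<^const>\<open>game_chromatic_number\<close> is attained on every finite graph.
\<close>

lemma ex_legal_move:
  assumes "\<not> game_over G k h"
  shows "\<exists>m. legal_move G k h m"
proof -
  from assms obtain v where v: "v \<in> verts G" "map_of h v = None"
    unfolding game_over_def all_colored_def by auto
  with assms obtain i where "i \<in> {1..k}" "\<forall>u. u \<rightarrow>\<^bsub>G\<^esub> v \<longrightarrow> map_of h u \<noteq> Some i"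
    unfolding game_over_def blocked_def by blast
  with v have "legal_move G k h (v, i)" by (simp add: legal_move_def)
  then show ?thesis ..
qed

lemma alice_wins_card_verts:
  assumes "Digraph.graph G"
  shows "alice_wins G (card (verts G))"
proof -
  interpret Digraph.graph G by fact
  let ?k = "card (verts G)"
  have not_blocked: "\<not> blocked G ?k h" for h
  proof
    assume "blocked G ?k h"
    then obtain v where v: "v \<in> verts G" "map_of h v = None"
      and all: "\<forall>i \<in> {1..?k}. \<exists>u. u \<rightarrow>\<^bsub>G\<^esub> v \<and> map_of h u = Some i"
      unfolding blocked_def by blast
    have "{1..?k} \<subseteq> (\<lambda>u. the (map_of h u)) ` (verts G - {v})"
    proof
      fix i assume "i \<in> {1..?k}"
      with all obtain u where u: "u \<rightarrow>\<^bsub>G\<^esub> v" "map_of h u = Some i" by blast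
      from u(1) have "u \<in> verts G" by auto
      moreover have "u \<noteq> v" using u(2) v(2) by auto
      ultimately show "i \<in> (\<lambda>u. the (map_of h u)) ` (verts G - {v})"
        using u(2) by (intro image_eqI[of _ _ u]) auto
    qed
    then have "card {1..?k} \<le> card (verts G - {v})"
      by (rule surj_card_le[rotated]) simp
    moreover have "card (verts G - {v}) < ?k"
      using v(1) by (intro card_Diff1_less) auto
    ultimately show False by simp
  qed
  have "alice_winning_strategy G ?k (\<lambda>h. SOME m. legal_move G ?k h m)"
    unfolding alice_winning_strategy_def alice_strategy_def
    using not_blocked ex_legal_move someI_ex by metis
  then show ?thesis unfolding alice_wins_def by blast
qed

end

theory Submission
  imports Defs
begin

text \<open>
  The witness is the complete multipartite graph with \<open>k\<close> parts of size two, together with one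
  isolated vertex.  Alice colors the isolated vertex first; afterwards she answers each of Bob's
  moves in the same part with the same color, so that \<open>k\<close> colors suffice.  When any vertex is
  deleted the parity changes: Bob can make Alice open a part, and he answers in that part with
  another color.  The final coloring then needs \<open>k + 1\<close> colors.
\<close>

section \<open>Plays and winning strategies\<close>

text \<open>\<open>map_of\<close> returns the first entry for a vertex, so an appended move takes
  effect only if its vertex has no color yet; legal moves satisfy this.\<close>

lemma map_of_snoc:
  "map_of h v = None \<Longrightarrow> map_of (h @ [(v, i)]) = (map_of h)(v \<mapsto> i)"
  by (auto simp: map_add_def fun_eq_iff split: option.splits)

lemma follows_Nil: "follows \<sigma> []"
  by (simp add: follows_def)

lemma follows_snoc:
  "follows \<sigma> (h @ [m]) \<longleftrightarrow> follows \<sigma> h \<and> (even (length h) \<longrightarrow> m = \<sigma> h)"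
  by (auto simp: follows_def nth_append less_Suc_eq)

lemma play_verts_colors:
  "play G k h \<Longrightarrow> map_of h v = Some i \<Longrightarrow> v \<in> verts G \<and> i \<in> {1..k}"
proof (induction arbitrary: v i rule: play.induct)
  case (move h m)
  then show ?case
    by (cases m) (auto simp: legal_move_def map_of_snoc split: if_splits)
qed simp

text \<open>Legality compares a new color only with neighbors colored earlier, along arcs into the
  new vertex; symmetry of \<open>G\<close> covers the arcs leaving it.\<close>

lemma play_proper:
  assumes G: "Digraph.graph G"
  shows "play G k h \<Longrightarrow> u \<rightarrow>\<^bsub>G\<^esub> v \<Longrightarrow> map_of h u = Some i \<Longrightarrow> map_of h v \<noteq> Some i"
proof (induction arbitrary: u v i rule: play.induct)
  case (move h m)
  interpret Digraph.graph G by fact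
  have "v \<rightarrow>\<^bsub>G\<^esub> u" "u \<noteq> v"
    using move.prems(1) graph_symmetric adj_not_same by blast+
  with move show ?case
    by (cases m) (auto simp: legal_move_def map_of_snoc split: if_splits)
qed simp

text \<open>Each move brings in at most one color. This keeps short positions from being blocked and
  supplies Bob with a color that is legal on every uncolored vertex.\<close>

lemma ex_fresh_color:
  assumes "length h < k"
  shows "\<exists>i \<in> {1..k}. \<forall>u. map_of h u \<noteq> Some i"
proof (rule ccontr)
  assume "\<not> ?thesis"
  then have "{1..k} \<subseteq> snd ` set h"
    by (force dest: map_of_SomeD)
  then have "card {1..k} \<le> card (snd ` set h)"
    by (intro card_mono) auto
  also have "\<dots> \<le> length h"
    by (metis card_image_le card_length le_trans List.finite_set)
  finally show False using assms by simp
qed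

lemma not_blocked_if_short: "length h < k \<Longrightarrow> \<not> blocked G k h"
  using ex_fresh_color[of h k] unfolding blocked_def by blast

lemma not_all_colored_if_short:
  assumes "length h < card (verts G)"
  shows "\<not> all_colored G h"
proof
  assume "all_colored G h"
  then have "verts G \<subseteq> fst ` set h"
    unfolding all_colored_def by (auto simp: map_of_eq_None_iff)
  then have "card (verts G) \<le> card (fst ` set h)"
    by (intro card_mono) auto
  also have "\<dots> \<le> length h"
    by (metis card_image_le card_length le_trans List.finite_set)
  finally show False using assms by simp
qed

text \<open>Every move lowers the number of uncolored vertices, so continuing with
  \<open>\<sigma>\<close> for Alice and arbitrary legal moves for Bob terminates.\<close>

lemma play_extends_to_end:
  assumes fin: "finite (verts G)" and \<sigma>: "alice_strategy G k \<sigma>"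
  shows "play G k h \<Longrightarrow> follows \<sigma> h \<Longrightarrow>
    \<exists>h'. play G k (h @ h') \<and> follows \<sigma> (h @ h') \<and> game_over G k (h @ h')"
proof (induction "card {v \<in> verts G. map_of h v = None}" arbitrary: h rule: less_induct)
  case less
  show ?case
  proof (cases "game_over G k h")
    case True
    with less.prems show ?thesis by (intro exI[of _ "[]"]) simp
  next
    case False
    obtain v i where legal: "legal_move G k h (v, i)" and turn: "even (length h) \<longrightarrow> (v, i) = \<sigma> h"
      using False less.prems(1) \<sigma> ex_legal_move[OF False]
      unfolding alice_strategy_def by (metis surj_pair)
    then have "{w \<in> verts G. map_of (h @ [(v, i)]) w = None} \<subset> {w \<in> verts G. map_of h w = None}"
      by (auto simp: legal_move_def map_of_snoc split: if_splits)
    then have "card {w \<in> verts G. map_of (h @ [(v, i)]) w = None} < card {w \<in> verts G. map_of h w = None}"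
      using fin by (intro psubset_card_mono) auto
    moreover have "play G k (h @ [(v, i)])" "follows \<sigma> (h @ [(v, i)])"
      using less.prems False legal turn by (auto simp: follows_snoc intro: play.move)
    ultimately obtain h' where "play G k ((h @ [(v, i)]) @ h')" "follows \<sigma> ((h @ [(v, i)]) @ h')"
      "game_over G k ((h @ [(v, i)]) @ h')"
      using less.hyps by blast
    then show ?thesis by (intro exI[of _ "(v, i) # h'"]) simp
  qed
qed

text \<open>The bridge from games to colorings used for all lower bounds: to refute a winning
  strategy, it suffices to reach a position that no proper coloring with \<open>k\<close> colors
  extends.\<close>

lemma winning_strategy_coloring:
  assumes G: "Digraph.graph G" and \<sigma>: "alice_winning_strategy G k \<sigma>"
    and h: "play G k h" "follows \<sigma> h"
  shows "\<exists>f. (\<forall>v \<in> verts G. f v \<in> {1..k}) \<and> (\<forall>u v. u \<rightarrow>\<^bsub>G\<^esub> v \<longrightarrow> f u \<noteq> f v) \<and>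
    (\<forall>v i. map_of h v = Some i \<longrightarrow> f v = i)"
proof -
  interpret Digraph.graph G by fact
  obtain h' where h': "play G k (h @ h')" "follows \<sigma> (h @ h')" "game_over G k (h @ h')"
    using play_extends_to_end[OF finite_verts _ h] \<sigma> unfolding alice_winning_strategy_def by blast
  then have all: "all_colored G (h @ h')"
    using \<sigma> unfolding alice_winning_strategy_def game_over_def by blast
  have ext: "map_of (h @ h') v = Some i" if "map_of h v = Some i" for v i
    using h'(1) that
  proof (induction h' rule: rev_induct)
    case (snoc m h')
    from snoc.prems(1) have "play G k (h @ h')" "legal_move G k (h @ h') m"
      by (auto elim: play.cases simp flip: append_assoc)
    with snoc show ?case
      by (cases m) (auto simp: legal_move_def map_of_snoc simp flip: append_assoc)
  qed simp
  show ?thesis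
  proof (intro exI conjI allI impI ballI)
    show "the (map_of (h @ h') v) \<in> {1..k}" if "v \<in> verts G" for v
      using that all play_verts_colors[OF h'(1)] unfolding all_colored_def by fastforce
    show "the (map_of (h @ h') u) \<noteq> the (map_of (h @ h') v)" if "u \<rightarrow>\<^bsub>G\<^esub> v" for u v
    proof -
      from that obtain i j where "map_of (h @ h') u = Some i" "map_of (h @ h') v = Some j"
        using all adj_in_verts unfolding all_colored_def by (metis not_None_eq)
      then show ?thesis using play_proper[OF G h'(1) that] by auto
    qed
    show "the (map_of (h @ h') v) = i" if "map_of h v = Some i" for v i
      using ext[OF that] by simp
  qed
qed

section \<open>The cocktail party graph with an isolated vertex\<close>

text \<open>
  The parts are the pairs \<open>{2 * c, 2 * c + 1}\<close> with \<open>c < k\<close>; every vertex \<open>v \<ge> 2 * k\<close> is isolated.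
\<close>

definition cocktail_on :: "nat \<Rightarrow> nat set \<Rightarrow> (nat, nat \<times> nat) pre_digraph" where
  "cocktail_on k V = \<lparr>verts = V,
     arcs = {(u, v). u \<in> V \<and> v \<in> V \<and> u < 2 * k \<and> v < 2 * k \<and> u div 2 \<noteq> v div 2},
     tail = fst, head = snd\<rparr>"

lemma verts_cocktail_on [simp]: "verts (cocktail_on k V) = V"
  by (simp add: cocktail_on_def)

lemma dominates_cocktail_on [simp]:
  "u \<rightarrow>\<^bsub>cocktail_on k V\<^esub> v \<longleftrightarrow>
    u \<in> V \<and> v \<in> V \<and> u < 2 * k \<and> v < 2 * k \<and> u div 2 \<noteq> v div 2"
  by (auto simp: cocktail_on_def arcs_ends_conv image_iff)

lemma graph_cocktail_on:
  assumes "finite V"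
  shows "Digraph.graph (cocktail_on k V)"
proof -
  have "arcs (cocktail_on k V) \<subseteq> V \<times> V" by (auto simp: cocktail_on_def)
  then have "finite (arcs (cocktail_on k V))" using assms by (meson finite_SigmaI finite_subset)
  moreover have "symmetric (cocktail_on k V)" by (auto simp: symmetric_def sym_def)
  ultimately show ?thesis
    using assms by unfold_locales (auto simp: cocktail_on_def arc_to_ends_def)
qed

text \<open>With the vertex set as a parameter and \<open>k\<close> fixed, deleting a vertex stays
  within the family.\<close>

lemma del_vert_cocktail_on:
  "pre_digraph.del_vert (cocktail_on k V) x = cocktail_on k (V - {x})"
  by (auto simp: pre_digraph.del_vert_def cocktail_on_def)

lemma not_connected_cocktail_on:
  assumes "finite V" "z \<in> V" "2 * k \<le> z" "V \<noteq> {z}"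
  shows "\<not> Digraph_Component.connected (cocktail_on k V)"
proof
  interpret Digraph.graph "cocktail_on k V" using graph_cocktail_on[OF assms(1)] .
  from assms obtain u where "u \<in> V" "u \<noteq> z" by auto
  moreover assume "Digraph_Component.connected (cocktail_on k V)"
  then have "strongly_connected (cocktail_on k V)"
    using symmetric_connected_imp_strongly_connected[OF sym_arcs] by simp
  ultimately have "z \<rightarrow>\<^sup>*\<^bsub>cocktail_on k V\<^esub> u"
    using assms(2) by (auto simp: strongly_connected_def)
  \<comment> \<open>A path from \<open>z\<close> to \<open>u\<close> would start with an arc leaving
    \<open>z\<close>, but \<open>z\<close> is isolated.\<close>
  then show False
    using \<open>u \<noteq> z\<close> assms(3) by (cases rule: converse_reachable_cases) auto
qed

section \<open>The involution exchanging the two vertices of a part\<close>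

definition partner :: "nat \<Rightarrow> nat" where
  "partner v = (if even v then v + 1 else v - 1)"

lemma partner_div [simp]: "partner v div 2 = v div 2"
  unfolding partner_def by presburger

lemma partner_neq [simp]: "partner v \<noteq> v" "v \<noteq> partner v"
  unfolding partner_def by presburger+

lemma partner_less [simp]: "partner v < 2 * k \<longleftrightarrow> v < 2 * k"
  unfolding partner_def by presburger

lemma partner_partner [simp]: "partner (partner v) = v"
  unfolding partner_def by presburger

lemma partner_eq_iff [simp]: "partner u = partner v \<longleftrightarrow> u = v"
  by (metis partner_partner)

lemma same_part_cases: "u div 2 = v div 2 \<longleftrightarrow> u = v \<or> u = partner v"
  unfolding partner_def by presburger

section \<open>Alice wins with \<open>k\<close> colors\<close>

text \<open>The kind of position that Alice restores with each of her moves. Having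
  \<open>2 * k\<close> colored forces Bob to play on a vertex with a partner.\<close>

definition matched :: "nat \<Rightarrow> nat history \<Rightarrow> bool" where
  "matched k h \<longleftrightarrow> map_of h (2 * k) \<noteq> None \<and> (\<forall>v < 2 * k. map_of h (partner v) = map_of h v)"

text \<open>After an even number of moves, Bob has just disturbed a matched position.\<close>

definition pairing_invariant :: "nat \<Rightarrow> nat history \<Rightarrow> bool" where
  "pairing_invariant k h \<longleftrightarrow> (if odd (length h) then matched k h
     else h = [] \<or> (\<exists>h' v i. h = h' @ [(v, i)] \<and> matched k h' \<and>
       legal_move (cocktail_on k {..2 * k}) k h' (v, i)))"

text \<open>The fallback to an arbitrary legal move is there because \<open>alice_strategy\<close>
  demands legality in every unfinished position on Alice's turn, also in those that the strategy
  never reaches.\<close>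

definition pairing_strategy :: "nat \<Rightarrow> nat history \<Rightarrow> nat move" where
  "pairing_strategy k h =
    (let m = if h = [] then (2 * k, 1) else (partner (fst (last h)), snd (last h))
     in if legal_move (cocktail_on k {..2 * k}) k h m then m
        else SOME m. legal_move (cocktail_on k {..2 * k}) k h m)"

lemma pairing_invariant:
  assumes "1 \<le> k"
  shows "play (cocktail_on k {..2 * k}) k h \<Longrightarrow> follows (pairing_strategy k) h \<Longrightarrow>
    pairing_invariant k h"
proof (induction rule: play.induct)
  case start
  then show ?case by (simp add: pairing_invariant_def)
next
  case (move h m)
  let ?G = "cocktail_on k {..2 * k}"
  have inv: "pairing_invariant k h"
    using move by (simp add: follows_snoc)
  obtain w j where m: "m = (w, j)" by (cases m)
  show ?case
  proof (cases "even (length h)")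
    case False
    \<comment> \<open>Bob's turn: a matched position followed by a legal move is the even case of
      the invariant.\<close>
    with inv move.hyps m show ?thesis by (auto simp: pairing_invariant_def)
  next
    case True
    then have m_eq: "m = pairing_strategy k h"
      using move.prems by (simp add: follows_snoc)
    show ?thesis
    proof (cases "h = []")
      case True
      then have "m = (2 * k, 1)"
        using m_eq assms by (simp add: pairing_strategy_def legal_move_def)
      \<comment> \<open>The first move touches no part, so all parts are still matched.\<close>
      moreover have "partner u \<noteq> 2 * k" if "u < 2 * k" for u
        using that partner_less[of u k] by linarith
      ultimately show ?thesis using True by (auto simp: pairing_invariant_def matched_def)
    next
      case False
      with inv \<open>even (length h)\<close> obtain h' v i where h: "h = h' @ [(v, i)]"
        and h': "matched k h'" and vi: "legal_move ?G k h' (v, i)"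
        by (auto simp: pairing_invariant_def)
      have v: "map_of h' v = None" "v < 2 * k" "i \<in> {1..k}"
        using vi h' by (auto simp: legal_move_def matched_def less_le)
      have map_h: "map_of h = (map_of h')(v \<mapsto> i)"
        using v(1) h by (simp add: map_of_snoc del: map_of_append)
      have pv: "map_of h (partner v) = None"
        using h' v map_h by (simp add: matched_def)
      \<comment> \<open>Partners have the same neighbors and are not adjacent, so the color that was
        legal for \<open>v\<close> remains legal for \<open>partner v\<close>.\<close>
      have "legal_move ?G k h (partner v, i)"
        using vi v pv partner_less[of v k] unfolding legal_move_def
        by (auto simp: map_h less_imp_le simp del: partner_less)
      then have "m = (partner v, i)"
        using m_eq h by (simp add: pairing_strategy_def)
      then have "map_of (h @ [m]) = (map_of h')(v \<mapsto> i, partner v \<mapsto> i)"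
        using pv map_h by (simp add: map_of_snoc del: map_of_append)
      moreover have "partner u = v \<longleftrightarrow> u = partner v" for u by auto
      moreover have "v \<noteq> 2 * k" "partner v \<noteq> 2 * k"
        using v(2) partner_less[of v k] by linarith+
      ultimately have "matched k (h @ [m])"
        using h' by (auto simp: matched_def simp del: map_of_append)
      then show ?thesis using \<open>even (length h)\<close> by (simp add: pairing_invariant_def)
    qed
  qed
qed

text \<open>In a matched position partners agree, and the part that Bob has just disturbed has only
  one colored vertex.\<close>

lemma pairing_invariant_same_color:
  assumes "pairing_invariant k h" "u < 2 * k" "map_of h u = Some i" "map_of h (partner u) = Some j"
  shows "i = j"
proof (cases "odd (length h)")
  case True
  with assms show ?thesis by (simp add: pairing_invariant_def matched_def)
next
  case False
  moreover have "h \<noteq> []" using assms by auto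
  ultimately obtain h' v i' where h: "h = h' @ [(v, i')]" and h': "matched k h'"
    and vi: "map_of h' v = None"
    using assms(1) by (auto simp: pairing_invariant_def legal_move_def)
  have map_h: "map_of h = (map_of h')(v \<mapsto> i')"
    using vi h by (simp add: map_of_snoc del: map_of_append)
  have "map_of h' (partner u) = map_of h' u" using h' assms(2) by (simp add: matched_def)
  then show ?thesis using assms(3,4) vi by (auto simp: map_h split: if_splits)
qed

text \<open>Each part shows at most one color, and the neighbors of a vertex lie in the other
  \<open>k - 1\<close> parts, so one color always remains.\<close>

lemma pairing_invariant_not_blocked:
  assumes "1 \<le> k" "pairing_invariant k h"
  shows "\<not> blocked (cocktail_on k {..2 * k}) k h"
proof
  let ?G = "cocktail_on k {..2 * k}"
  assume "blocked ?G k h"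
  then obtain w where all: "\<forall>i \<in> {1..k}. \<exists>u. u \<rightarrow>\<^bsub>?G\<^esub> w \<and> map_of h u = Some i"
    unfolding blocked_def by blast
  then obtain g where g: "\<And>i. i \<in> {1..k} \<Longrightarrow> g i \<rightarrow>\<^bsub>?G\<^esub> w \<and> map_of h (g i) = Some i"
    by metis
  have w: "w < 2 * k" using g[of 1] assms(1) by auto
  have "inj_on (\<lambda>i. g i div 2) {1..k}"
  proof (rule inj_onI)
    fix i j assume ij: "i \<in> {1..k}" "j \<in> {1..k}" "g i div 2 = g j div 2"
    then consider "g i = g j" | "g i = partner (g j)" using same_part_cases by blast
    then show "i = j"
    proof cases
      case 1
      then show ?thesis using g[OF ij(1)] g[OF ij(2)] by (metis option.inject)
    next
      case 2
      then show ?thesis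
        using pairing_invariant_same_color[OF assms(2), of "g j" j i] g[OF ij(1)] g[OF ij(2)]
        by (metis dominates_cocktail_on)
    qed
  qed
  moreover have "(\<lambda>i. g i div 2) ` {1..k} \<subseteq> {..<k} - {w div 2}"
    using g by fastforce
  ultimately have "card {1..k} \<le> card ({..<k} - {w div 2})"
    by (rule card_inj_on_le) simp
  also have "\<dots> < card {..<k}"
    using w by (intro card_Diff1_less) auto
  finally show False by simp
qed

lemma alice_wins_cocktail:
  assumes "1 \<le> k"
  shows "alice_wins (cocktail_on k {..2 * k}) k"
proof -
  let ?G = "cocktail_on k {..2 * k}"
  have "legal_move ?G k h (pairing_strategy k h)" if "\<not> game_over ?G k h" for h
    using someI_ex[OF ex_legal_move[OF that]] by (simp add: pairing_strategy_def Let_def)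
  then have "alice_strategy ?G k (pairing_strategy k)"
    by (simp add: alice_strategy_def)
  then show ?thesis
    using pairing_invariant pairing_invariant_not_blocked assms
    unfolding alice_wins_def alice_winning_strategy_def by blast
qed

section \<open>Lower bounds\<close>

lemma proper_coloring_card_le:
  fixes f :: "'a \<Rightarrow> nat"
  assumes "\<And>u v. u \<in> T \<Longrightarrow> v \<in> T \<Longrightarrow> u \<noteq> v \<Longrightarrow> f u \<noteq> f v" "\<And>v. v \<in> T \<Longrightarrow> f v \<in> {1..k}"
  shows "card T \<le> k"
proof -
  have "inj_on f T" "f ` T \<subseteq> {1..k}" using assms by (auto simp: inj_on_def)
  then show ?thesis using card_inj_on_le[of f T "{1..k}"] by simp
qed

lemma game_chromatic_number_cocktail:
  assumes "1 \<le> k"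
  shows "game_chromatic_number (cocktail_on k {..2 * k}) = k"
  unfolding game_chromatic_number_def
proof (rule Least_equality)
  let ?G = "cocktail_on k {..2 * k}"
  show "alice_wins ?G k" using alice_wins_cocktail[OF assms] .
  fix m assume "alice_wins ?G m"
  then obtain \<sigma> where \<sigma>: "alice_winning_strategy ?G m \<sigma>" unfolding alice_wins_def ..
  have "Digraph.graph ?G" by (simp add: graph_cocktail_on)
  from winning_strategy_coloring[OF this \<sigma> play.start follows_Nil]
  obtain f where f: "\<And>v. v \<in> verts ?G \<Longrightarrow> f v \<in> {1..m}"
    "\<And>u v. u \<rightarrow>\<^bsub>?G\<^esub> v \<Longrightarrow> f u \<noteq> f v"
    by blast
  \<comment> \<open>The even vertices below \<open>2 * k\<close>, one from each part, form a clique
    of size \<open>k\<close>.\<close>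
  have "card ((*) 2 ` {..<k}) \<le> m"
  proof (rule proper_coloring_card_le[of _ f])
    fix v assume "v \<in> (*) 2 ` {..<k}"
    then show "f v \<in> {1..m}" by (intro f(1)) auto
  qed (auto intro!: f(2))
  then show "k \<le> m" by (simp add: card_image inj_on_def)
qed

section \<open>Bob's play after the deletion of a vertex\<close>

text \<open>Each of the \<open>k - 1\<close> parts other than that of \<open>a\<close> keeps a
  vertex. Together with \<open>a\<close> and its partner these are \<open>k + 1\<close> vertices,
  pairwise adjacent except for the two partners, whose colors differ by assumption.\<close>

lemma two_colored_part_loses:
  assumes \<sigma>: "alice_winning_strategy (cocktail_on k ({..2 * k} - {x})) k \<sigma>"
    and h: "play (cocktail_on k ({..2 * k} - {x})) k h" "follows \<sigma> h"
    and ab: "map_of h a = Some i" "map_of h (partner a) = Some j" "i \<noteq> j" "a < 2 * k"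
  shows False
proof -
  let ?V = "{..2 * k} - {x}" and ?G = "cocktail_on k ({..2 * k} - {x})"
  have "Digraph.graph ?G" by (simp add: graph_cocktail_on)
  from winning_strategy_coloring[OF this \<sigma> h]
  obtain f where f: "\<And>v. v \<in> verts ?G \<Longrightarrow> f v \<in> {1..k}"
    "\<And>u v. u \<rightarrow>\<^bsub>?G\<^esub> v \<Longrightarrow> f u \<noteq> f v" "\<And>v i. map_of h v = Some i \<Longrightarrow> f v = i"
    by blast
  \<comment> \<open>A representative of part \<open>c\<close> that survives the deletion: the even
    vertex, or the odd one if the even one is \<open>x\<close>.\<close>
  define rep where "rep c = (if x = 2 * c then 2 * c + 1 else 2 * c)" for c
  define R where "R = rep ` ({..<k} - {a div 2})"
  have rep_div [simp]: "rep c div 2 = c" for c unfolding rep_def by simp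
  have rep_x: "rep c \<noteq> x" for c unfolding rep_def by presburger
  have rep_less: "rep c < 2 * k" if "c < k" for c using that unfolding rep_def by auto
  have RV: "v \<in> ?V" "v < 2 * k" "v div 2 \<noteq> a div 2" if "v \<in> R" for v
    using that rep_x rep_less unfolding R_def by (auto simp: less_imp_le)
  have R_part: "u = v" if "u \<in> R" "v \<in> R" "u div 2 = v div 2" for u v
    using that unfolding R_def by auto
  have abV: "a \<in> ?V" "partner a \<in> ?V"
    using ab play_verts_colors[OF h(1)] by fastforce+
  have fab: "f a \<noteq> f (partner a)" using f(3) ab by fastforce
  have "card R = k - 1"
    unfolding R_def using ab(4) by (subst card_image) (auto intro: inj_on_inverseI[of _ "\<lambda>v. v div 2"])
  moreover have "a \<notin> R" "partner a \<notin> R" using RV(3) partner_div by blast+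
  moreover have "finite R" by (simp add: R_def)
  ultimately have "card (insert a (insert (partner a) R)) = k + 1"
    using ab(4) by simp
  moreover have "card (insert a (insert (partner a) R)) \<le> k"
  proof (rule proper_coloring_card_le[of _ f])
    fix u v assume uv: "u \<in> insert a (insert (partner a) R)" "v \<in> insert a (insert (partner a) R)" "u \<noteq> v"
    show "f u \<noteq> f v"
    proof (cases "u div 2 = v div 2")
      case False
      then show ?thesis using uv abV RV ab(4) by (intro f(2)) auto
    next
      case True
      then show ?thesis using uv fab RV(3) R_part by (metis insertE partner_div)
    qed
  next
    fix v assume "v \<in> insert a (insert (partner a) R)"
    then show "f v \<in> {1..k}" using abV RV by (intro f(1)) auto
  qed
  ultimately show False by simp
qed

lemma opening_part_loses:
  assumes \<sigma>: "alice_winning_strategy (cocktail_on k ({..2 * k} - {x})) k \<sigma>"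
    and h: "play (cocktail_on k ({..2 * k} - {x})) k h" "follows \<sigma> h"
    and len: "even (length h)" "length h + 1 < k"
    and v: "fst (\<sigma> h) < 2 * k" "partner (fst (\<sigma> h)) \<noteq> x" "map_of h (partner (fst (\<sigma> h))) = None"
  shows False
proof -
  let ?G = "cocktail_on k ({..2 * k} - {x})"
  obtain v i where vi: "\<sigma> h = (v, i)" by force
  have pv: "partner v \<in> verts ?G" "map_of h (partner v) = None" "v < 2 * k"
    using v vi partner_less[of v k] by (auto simp: less_imp_le)
  have "\<not> game_over ?G k h"
    using len(2) pv not_blocked_if_short[of h k ?G] unfolding game_over_def all_colored_def by auto
  moreover from this have legal: "legal_move ?G k h (v, i)"
    using \<sigma> h(1) len(1) vi unfolding alice_winning_strategy_def alice_strategy_def by metis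
  ultimately have h1: "play ?G k (h @ [(v, i)])" "follows \<sigma> (h @ [(v, i)])"
    using h vi by (auto simp: follows_snoc intro: play.move)
  have map_h1: "map_of (h @ [(v, i)]) = (map_of h)(v \<mapsto> i)"
    using legal by (simp add: map_of_snoc legal_move_def del: map_of_append)
  have over: "\<not> game_over ?G k (h @ [(v, i)])"
    using len(2) pv not_blocked_if_short[of "h @ [(v, i)]" k ?G] map_h1
    unfolding game_over_def all_colored_def
    by (auto simp del: map_of_append intro!: bexI[of _ "partner v"])
  obtain j where j: "j \<in> {1..k}" "\<And>u. map_of (h @ [(v, i)]) u \<noteq> Some j"
    using ex_fresh_color[of "h @ [(v, i)]" k] len(2) by auto
  have j': "legal_move ?G k (h @ [(v, i)]) (partner v, j)"
    using j pv unfolding legal_move_def by (auto simp: map_h1 simp del: map_of_append)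
  have h2: "play ?G k ((h @ [(v, i)]) @ [(partner v, j)])" "follows \<sigma> ((h @ [(v, i)]) @ [(partner v, j)])"
    using h1 over j' len(1) by (auto simp only: follows_snoc length_append_singleton even_Suc intro: play.move)
  have "map_of ((h @ [(v, i)]) @ [(partner v, j)]) = (map_of h)(v \<mapsto> i, partner v \<mapsto> j)"
    using map_h1 pv(2) by (simp add: map_of_snoc del: map_of_append append_assoc)
  then show False
    using j(2)[of v] map_h1 pv(3)
    by (intro two_colored_part_loses[OF \<sigma> h2, of v i j]) (auto simp del: map_of_append)
qed

text \<open>Alice can avoid opening a part only on a vertex whose partner is absent. If
  \<open>x = 2 * k\<close> there is none; otherwise there are two, \<open>2 * k\<close> and
  \<open>partner x\<close>, and they are gone after one move by each player.\<close>

lemma not_alice_wins_cocktail_del: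
  assumes k: "4 \<le> k" and x: "x \<le> 2 * k"
  shows "\<not> alice_wins (cocktail_on k ({..2 * k} - {x})) k"
proof
  let ?V = "{..2 * k} - {x}" and ?G = "cocktail_on k ({..2 * k} - {x})"
  assume "alice_wins ?G k"
  then obtain \<sigma> where \<sigma>: "alice_winning_strategy ?G k \<sigma>" unfolding alice_wins_def ..
  have card: "card (verts ?G) = 2 * k" using x by simp
  have not_over: "\<not> game_over ?G k h" if "length h \<le> 2" for h
    using that k card not_blocked_if_short[of h k ?G] not_all_colored_if_short[of h ?G]
    unfolding game_over_def by auto
  have legal: "legal_move ?G k h (\<sigma> h)" if "play ?G k h" "even (length h)" "length h \<le> 2" for h
    using \<sigma> that not_over unfolding alice_winning_strategy_def alice_strategy_def by blast
  obtain v i where vi: "\<sigma> [] = (v, i)" by force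
  have legal1: "legal_move ?G k [] (v, i)" using legal[OF play.start] vi by simp
  then have v: "v \<in> ?V" by (simp add: legal_move_def)
  have bad: "\<not> (v < 2 * k \<and> partner v \<noteq> x)"
    using opening_part_loses[OF \<sigma> play.start follows_Nil] k vi by auto
  have "x \<noteq> 2 * k"
  proof
    assume "x = 2 * k"
    then have "v < 2 * k" using v by auto
    with bad \<open>x = 2 * k\<close> show False by (metis partner_less less_irrefl)
  qed
  then have x2: "x < 2 * k" using x by simp
  text \<open>Alice has taken one of the two vertices without a partner; Bob takes the other one, \<open>w\<close>.\<close>
  define w where "w = (if v = 2 * k then partner x else 2 * k)"
  have v': "v = 2 * k \<or> v = partner x" using v bad by auto
  have px: "partner x < 2 * k" "partner x \<noteq> x" using x2 by simp_all
  have w: "w \<in> ?V" "w \<noteq> v" "{v, w} = {2 * k, partner x}"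
    using v' x2 px unfolding w_def by (auto simp del: partner_less partner_neq)
  have h1: "play ?G k [(v, i)]" "follows \<sigma> [(v, i)]"
    using play.move[OF play.start not_over legal1] follows_snoc[of \<sigma> "[]" "(v, i)"] vi
    by (auto simp: follows_Nil)
  obtain j where "j \<in> {1..k}" "\<And>u. map_of [(v, i)] u \<noteq> Some j"
    using ex_fresh_color[of "[(v, i)]" k] k by auto
  then have "legal_move ?G k [(v, i)] (w, j)"
    using w by (auto simp: legal_move_def split: if_splits)
  then have h2: "play ?G k [(v, i), (w, j)]" "follows \<sigma> [(v, i), (w, j)]"
    using play.move[OF h1(1) not_over] h1(2) follows_snoc[of \<sigma> "[(v, i)]" "(w, j)"] by auto
  obtain v' i' where vi': "\<sigma> [(v, i), (w, j)] = (v', i')" by force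
  have "v' \<in> ?V" "v' \<notin> {v, w}"
    using legal[OF h2(1)] vi' by (auto simp: legal_move_def split: if_splits)
  \<comment> \<open>Alice's second move therefore falls into a part that is complete and still
    uncolored.\<close>
  then have v'': "v' < 2 * k" "v' \<noteq> x" "v' \<noteq> partner x" using w(3) by auto
  then have "partner v' < 2 * k" "partner v' \<noteq> partner x" "partner v' \<noteq> x"
    by (auto simp only: partner_less partner_eq_iff partner_partner)
  moreover from this have "partner v' \<notin> {v, w}" unfolding w(3) by (auto simp del: partner_less)
  \<comment> \<open>Two moves have been made, so the fresh color for Bob's answer requires
    \<open>2 + 1 < k\<close>, that is \<open>4 \<le> k\<close>.\<close>
  ultimately show False
    using opening_part_loses[OF \<sigma> h2] vi' v'' k by auto
qed

theorem proposition5: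
  fixes k :: nat
  assumes "4 \<le> k"
  shows "\<exists>G :: (nat, nat \<times> nat) pre_digraph.
    Digraph.graph G \<and> \<not> Digraph_Component.connected G \<and> game_vertex_critical k G"
proof (intro exI conjI)
  let ?G = "cocktail_on k {..2 * k}"
  show "Digraph.graph ?G" by (simp add: graph_cocktail_on)
  have "0 \<in> {..2 * k} - {2 * k}" using assms by simp
  then have "{..2 * k} \<noteq> {2 * k}" by blast
  then show "\<not> Digraph_Component.connected ?G"
    by (intro not_connected_cocktail_on[of _ "2 * k"]) auto
  have chi: "game_chromatic_number ?G = k"
    using assms by (intro game_chromatic_number_cocktail) simp
  have "game_chromatic_number (pre_digraph.del_vert ?G x) \<noteq> k" if "x \<in> verts ?G" for x
  proof
    let ?H = "cocktail_on k ({..2 * k} - {x})"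
    assume "game_chromatic_number (pre_digraph.del_vert ?G x) = k"
    \<comment> \<open>The minimum is attained, since Alice wins with \<open>card (verts ?H)\<close>
      colors; a value of \<open>k\<close> would thus give her a win with \<open>k\<close>
      colors.\<close>
    moreover have "alice_wins ?H (game_chromatic_number ?H)"
      unfolding game_chromatic_number_def
      by (rule LeastI, rule alice_wins_card_verts) (simp add: graph_cocktail_on)
    ultimately have "alice_wins ?H k" by (simp add: del_vert_cocktail_on)
    with not_alice_wins_cocktail_del[OF assms] that show False by simp
  qed
  with chi show "game_vertex_critical k ?G" by (simp add: game_vertex_critical_def)
qed

end
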